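(* For every $\epsilon>0$, every integer $r\ge 2$ and every real $k\ge 1$, there exists $\ell_0=\ell_0(r,k,\epsilon)$ such that the following holds. Let $G$ be a graph with maximum degree $\Delta(G)=\Delta$ and minimum degree $\delta(G)=\delta$ such that $\frac{\Delta}{\delta}\le k$. If $\mathrm{ch}(G)\ge \ell_0$, then $$\mathrm{ch}_r(G)\le (1+\epsilon)\,\mathrm{ch}(G).$$
   Context: Graphs are finite and simple. The condition $\Delta/\delta\le k$ includes that $\delta>0$. $N_G(v)$ is the set of neighbors of $v$ and $d_G(v)=|N_G(v)|$. The choice number $\mathrm{ch}(G)$ is the least $k$ such that for every assignment of sets (lists) $L(v)$ with $|L(v)|\ge k$ to the vertices $v\in V(G)$ there is a proper coloring $f$ of $G$ with $f(v)\in L(v)$ for all $v$. For a positive integer $r$, an $r$-dynamic coloring of $G$ is a proper coloring $f$ such that $|f(N_G(v))|\ge\min\{r,d_G(v)\}$ for every vertex $v$. The $r$-dynamic choosability $\mathrm{ch}_r(G)$ is the least positive integer $k$ such that for every assignment of lists $L(v)$ with $|L(v)|\ge k$ to the vertices $v\in V(G)$ there is an $r$-dynamic coloring $f$ of $G$ with $f(v)\in L(v)$ for all $v\in V(G)$. *)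

theory Defs
  imports Complex_Main "Graph_Theory.Pair_Digraph"
begin

text \<open>
  A finite simple graph is a \<^locale>\<open>pair_graph\<close>: a finite vertex set with a symmetric,
  irreflexive arc relation, each undirected edge being represented by its two arcs.
\<close>

definition neighbors :: "'a pair_pre_digraph \<Rightarrow> 'a \<Rightarrow> 'a set" where
  "neighbors G v = {w. (v, w) \<in> parcs G}"

definition degree :: "'a pair_pre_digraph \<Rightarrow> 'a \<Rightarrow> nat" where
  "degree G v = card (neighbors G v)"

text \<open>
  The maximum and minimum degree are unspecified for the graph without vertices.
\<close>

definition max_degree :: "'a pair_pre_digraph \<Rightarrow> nat" where
  "max_degree G = Max (degree G ` pverts G)"

definition min_degree :: "'a pair_pre_digraph \<Rightarrow> nat" where
  "min_degree G = Min (degree G ` pverts G)"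

definition proper_coloring :: "'a pair_pre_digraph \<Rightarrow> ('a \<Rightarrow> 'c) \<Rightarrow> bool" where
  "proper_coloring G f \<longleftrightarrow> (\<forall>(u, v) \<in> parcs G. f u \<noteq> f v)"

definition dynamic_coloring :: "nat \<Rightarrow> 'a pair_pre_digraph \<Rightarrow> ('a \<Rightarrow> 'c) \<Rightarrow> bool" where
  "dynamic_coloring r G f \<longleftrightarrow> proper_coloring G f \<and>
     (\<forall>v \<in> pverts G. min r (degree G v) \<le> card (f ` neighbors G v))"

text \<open>
  Colors are natural numbers. Nothing is lost by this: the graph is finite and every list may
  be shrunk to a finite one, so only finitely many colors matter. Lists are allowed to be
  infinite; as \<^const>\<open>card\<close> is 0 on infinite sets, this case of ``at least \<open>k\<close> colors'' is
  spelled out separately.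
\<close>

definition list_assignment :: "'a pair_pre_digraph \<Rightarrow> nat \<Rightarrow> ('a \<Rightarrow> nat set) \<Rightarrow> bool" where
  "list_assignment G k L \<longleftrightarrow> (\<forall>v \<in> pverts G. infinite (L v) \<or> k \<le> card (L v))"

definition choosable :: "'a pair_pre_digraph \<Rightarrow> nat \<Rightarrow> bool" where
  "choosable G k \<longleftrightarrow> (\<forall>L. list_assignment G k L \<longrightarrow>
     (\<exists>f. proper_coloring G f \<and> (\<forall>v \<in> pverts G. f v \<in> L v)))"

definition dynamic_choosable :: "nat \<Rightarrow> 'a pair_pre_digraph \<Rightarrow> nat \<Rightarrow> bool" where
  "dynamic_choosable r G k \<longleftrightarrow> (\<forall>L. list_assignment G k L \<longrightarrow>
     (\<exists>f. dynamic_coloring r G f \<and> (\<forall>v \<in> pverts G. f v \<in> L v)))"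

text \<open>
  Both minima below are attained on finite graphs: if every list has at least as many colors as
  there are vertices, then all vertices can be given different colors.
\<close>

definition choice_number :: "'a pair_pre_digraph \<Rightarrow> nat" where
  "choice_number G = (LEAST k. choosable G k)"

definition dynamic_choice_number :: "nat \<Rightarrow> 'a pair_pre_digraph \<Rightarrow> nat" where
  "dynamic_choice_number r G = (LEAST k. 0 < k \<and> dynamic_choosable r G k)"

end

theory Submission
  imports Defs "HOL-Library.FuncSet"
begin

text \<open>
  Write \<open>c\<close> for the choice number, and let every list have \<open>t = \<lfloor>(1 + \<epsilon>) c\<rfloor>\<close> colors. Replace each list by
  a random sublist of at least \<open>c\<close> colors; whatever the outcome, there is a proper coloring from the
  sublists. If it uses fewer than \<open>r\<close> colors on the neighborhood of \<open>v\<close>, then these colors form a set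
  \<open>R\<close> of at most \<open>r - 1\<close> colors that meets the sublist of every neighbor of \<open>v\<close>. So it is enough to
  choose the sublists in such a way that no set of at most \<open>r - 1\<close> colors meets all the sublists around
  any vertex; then \<^emph>\<open>every\<close> proper coloring from the sublists is \<open>r\<close>-dynamic.

  A sublist arises by deleting \<open>r - 1\<close> or fewer of \<open>b\<close> blocks that make up the list, where \<open>b\<close> depends only on
  \<open>r\<close> and \<open>\<epsilon>\<close> (\<open>block_removals\<close>). There are \<open>N\<close> ways to do so, again a constant, and for every \<open>R\<close>
  one of them deletes all of \<open>R\<close>. Hence a given \<open>R\<close> meets all sublists around \<open>v\<close> with probability at most
  \<open>(1 - 1 / N) ^ d(v)\<close>. This is exponentially small in \<open>\<Delta>\<close> because \<open>d(v) \<ge> \<Delta> / k\<close>, whereas the number of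
  relevant sets \<open>R\<close> is at most \<open>(\<Delta> t) ^ (r - 1)\<close>, which is polynomial in \<open>\<Delta>\<close> since greedy coloring gives
  \<open>c \<le> \<Delta> + 1\<close>. That inequality also shows that \<open>\<Delta>\<close> is large when \<open>c\<close> is. As each bad event depends
  only on the sublists around one vertex, a local lemma argument provides sublists that avoid all bad
  events (\<open>exists_unhit_choice\<close>, \<open>dynamic_choosable_of_choosable\<close>).

  The local lemma is replaced by a count in the style of Rosenfeld: assign sublists one vertex at a
  time and show that the number of partial assignments without violations grows by a factor of nearly
  \<open>N\<close> in each step (\<open>avoiding_growth\<close>).
\<close>

section \<open>Avoiding local forbidden patterns by counting\<close>

text \<open>
  \<open>C\<close> is the set of values, \<open>S i\<close> the scope of the \<open>i\<close>-th constraint and \<open>B i\<close> the set of its forbidden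
  patterns. Only constraints with scope inside \<open>T\<close> are imposed, so that partial
  assignments can be counted as \<open>T\<close> grows.
\<close>

definition avoiding :: "'v set \<Rightarrow> 'c set \<Rightarrow> 'i set \<Rightarrow> ('i \<Rightarrow> 'v set) \<Rightarrow> ('i \<Rightarrow> ('v \<Rightarrow> 'c) set) \<Rightarrow> ('v \<Rightarrow> 'c) set"
  where "avoiding T C I S B =
    {g \<in> T \<rightarrow>\<^sub>E C. \<forall>i\<in>I. S i \<subseteq> T \<longrightarrow> restrict g (S i) \<notin> B i}"

lemma finite_avoiding: "finite T \<Longrightarrow> finite C \<Longrightarrow> finite (avoiding T C I S B)"
  unfolding avoiding_def by (rule finite_subset[OF _ finite_PiE[of T "\<lambda>_. C"]]) auto

lemma restrict_avoiding:
  assumes "g \<in> avoiding T C I S B" "T' \<subseteq> T"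
  shows "restrict g T' \<in> avoiding T' C I S B"
proof -
  have "restrict (restrict g T') (S i) = restrict g (S i)" if "S i \<subseteq> T'" for i
    using that by (auto simp: restrict_def fun_eq_iff)
  then show ?thesis
    using assms unfolding avoiding_def by (auto simp: PiE_iff)
qed

lemma card_extensions:
  fixes C :: "'c set"
  assumes "u \<in> T" "A \<subseteq> (T - {u}) \<rightarrow>\<^sub>E C"
  shows "card {g \<in> T \<rightarrow>\<^sub>E C. restrict g (T - {u}) \<in> A} = card A * card C"
proof -
  have "bij_betw (\<lambda>(h, c). h(u := c)) (A \<times> C) {g \<in> T \<rightarrow>\<^sub>E C. restrict g (T - {u}) \<in> A}"
  proof (rule bij_betw_byWitness[where f' = "\<lambda>g. (restrict g (T - {u}), g u)"])
    have upd: "restrict (h(u := c)) (T - {u}) = h" if "h \<in> A" for h and c :: 'c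
    proof -
      have "h \<in> (T - {u}) \<rightarrow>\<^sub>E C" using that assms by auto
      then show ?thesis by (auto simp: fun_eq_iff restrict_def PiE_iff extensional_def)
    qed
    show "\<forall>a\<in>A \<times> C. (\<lambda>g. (restrict g (T - {u}), g u)) ((\<lambda>(h, c). h(u := c)) a) = a"
      using upd by auto
    show "\<forall>g\<in>{g \<in> T \<rightarrow>\<^sub>E C. restrict g (T - {u}) \<in> A}.
        (\<lambda>(h, c). h(u := c)) ((\<lambda>g. (restrict g (T - {u}), g u)) g) = g"
      using assms(1) by (auto simp: fun_eq_iff restrict_def PiE_iff extensional_def)
    have "h(u := c) \<in> T \<rightarrow>\<^sub>E C" if "h \<in> A" "c \<in> C" for h c
    proof -
      have "h \<in> (T - {u}) \<rightarrow>\<^sub>E C" using that assms by auto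
      then show ?thesis using that assms(1) by (auto simp: PiE_iff extensional_def)
    qed
    then show "(\<lambda>(h, c). h(u := c)) ` (A \<times> C) \<subseteq> {g \<in> T \<rightarrow>\<^sub>E C. restrict g (T - {u}) \<in> A}"
      using upd by auto
    show "(\<lambda>g. (restrict g (T - {u}), g u)) ` {g \<in> T \<rightarrow>\<^sub>E C. restrict g (T - {u}) \<in> A} \<subseteq> A \<times> C"
      using assms(1) by auto
  qed
  then show ?thesis
    by (simp add: bij_betw_same_card[symmetric] card_cartesian_product)
qed

lemma card_split_le:
  assumes "finite X" "finite Y" "U \<subseteq> T"
  shows "card {g \<in> T \<rightarrow>\<^sub>E C. restrict g (T - U) \<in> X \<and> restrict g U \<in> Y} \<le> card X * card Y"
proof -
  let ?Z = "{g \<in> T \<rightarrow>\<^sub>E C. restrict g (T - U) \<in> X \<and> restrict g U \<in> Y}"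
  let ?f = "\<lambda>g. (restrict g (T - U), restrict g U)"
  have "inj_on ?f ?Z"
  proof (rule inj_onI, rule ext)
    fix g h x assume gh: "g \<in> ?Z" "h \<in> ?Z" and eq: "?f g = ?f h"
    consider "x \<in> U" | "x \<in> T - U" | "x \<notin> T" using assms(3) by blast
    then show "g x = h x"
    proof cases
      case 1 then show ?thesis using eq by (metis prod.inject restrict_apply')
    next
      case 2 then show ?thesis using eq by (metis prod.inject restrict_apply')
    next
      case 3 then show ?thesis using gh by (auto simp: PiE_iff extensional_def)
    qed
  qed
  moreover have "?f ` ?Z \<subseteq> X \<times> Y" by auto
  ultimately have "card ?Z \<le> card (X \<times> Y)" using assms by (intro card_inj_on_le) auto
  then show ?thesis by (simp add: card_cartesian_product)
qed

text \<open>
  Deleting the points of \<open>U\<close> one at a time costs a factor \<open>\<beta>\<close> each. The growth hypothesis is only asked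
  for subsets of \<open>T\<close>, so that the lemma can be used inside an induction on the cardinality of \<open>T\<close>.
\<close>

lemma growth_iterate:
  fixes a :: "'v set \<Rightarrow> real" and \<beta> :: real
  assumes "finite U" "0 \<le> \<beta>" "U \<subseteq> T"
    and step: "\<And>T' u. T' \<subseteq> T \<Longrightarrow> u \<in> T' \<Longrightarrow> \<beta> * a (T' - {u}) \<le> a T'"
  shows "\<beta> ^ card U * a (T - U) \<le> a T"
  using assms(1,3)
proof (induction U rule: finite_induct)
  case (insert x F)
  have "\<beta> ^ card (insert x F) * a (T - insert x F) = \<beta> ^ card F * (\<beta> * a (T - F - {x}))"
    using insert.hyps by (simp add: Diff_insert[of T x F] mult.left_commute mult.assoc)
  also have "\<dots> \<le> \<beta> ^ card F * a (T - F)"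
    using insert assms(2) by (intro mult_left_mono step) auto
  also have "\<dots> \<le> a T" using insert by auto
  finally show ?case .
qed simp

text \<open>
  The inductive core of the counting argument. Each of the \<open>N\<close> values at a new point \<open>u\<close> extends an
  avoiding assignment on \<open>T - {u}\<close>, and the only extensions lost are those that violate one of the at
  most \<open>D\<close> constraints \<open>i\<close> with \<open>u \<in> S i\<close>. A lost extension consists of an avoiding assignment on
  \<open>T - S i\<close> and a forbidden pattern on \<open>S i\<close>. By induction, going from \<open>T - S i\<close> to \<open>T - {u}\<close>
  multiplies the count by at least \<open>((1 - 1 / (2 D)) N) ^ (card (S i) - 1)\<close>, which is at least half of
  \<open>N ^ (card (S i) - 1)\<close>. So each constraint costs at most a fraction \<open>1 / (2 D\<^sup>2)\<close> of the \<open>N\<close>-fold count,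
  and all of them together at most \<open>1 / (2 D)\<close>, which is what the claimed factor allows.
\<close>

lemma avoiding_growth:
  fixes D :: nat
  assumes fin: "finite V" "finite C" "finite I" and C: "C \<noteq> {}"
    and S: "\<And>i. i \<in> I \<Longrightarrow> card (S i) \<le> D"
    and deg: "\<And>v. v \<in> V \<Longrightarrow> card {i \<in> I. v \<in> S i} \<le> D"
    and B: "\<And>i. i \<in> I \<Longrightarrow> B i \<subseteq> S i \<rightarrow>\<^sub>E C"
    and few: "\<And>i. i \<in> I \<Longrightarrow> 4 * real D ^ 2 * real (card (B i)) \<le> real (card C) ^ card (S i)"
    and D: "D > 0" and T: "T \<subseteq> V" "u \<in> T"
  defines "a \<equiv> \<lambda>T. real (card (avoiding T C I S B))"
  shows "(1 - 1 / (2 * real D)) * real (card C) * a (T - {u}) \<le> a T"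
proof -
  define N where "N = real (card C)"
  define \<beta> where "\<beta> = (1 - 1 / (2 * real D)) * N"
  have N: "N > 0" using C fin by (simp add: N_def card_gt_0_iff)
  have \<beta>: "\<beta> > 0" using N D by (simp add: \<beta>_def field_simps)
  have "finite T" using T fin finite_subset by auto
  then show ?thesis using T unfolding N_def[symmetric] \<beta>_def[symmetric]
  proof (induction "card T" arbitrary: T u rule: less_induct)
    case less
    let ?T0 = "T - {u}"
    have aT: "finite (avoiding T' C I S B)" if "T' \<subseteq> T" for T'
      using that less.prems(1) fin(2) finite_subset by (intro finite_avoiding) auto
    define X where "X i = {g \<in> T \<rightarrow>\<^sub>E C. restrict g (T - S i) \<in> avoiding (T - S i) C I S B
        \<and> restrict g (S i) \<in> B i}" for i
    define J where "J = {i \<in> I. u \<in> S i \<and> S i \<subseteq> T}"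
    define E where "E = {g \<in> T \<rightarrow>\<^sub>E C. restrict g ?T0 \<in> avoiding ?T0 C I S B}"
    have finX: "finite (X i)" for i unfolding X_def
      by (rule finite_subset[OF _ finite_PiE[of T "\<lambda>_. C"]]) (use less.prems fin in auto)
    have finJ: "finite J" using fin by (simp add: J_def)
    have finE: "finite E" unfolding E_def
      by (rule finite_subset[OF _ finite_PiE[of T "\<lambda>_. C"]]) (use less.prems fin in auto)
    have cardE: "card E = card (avoiding ?T0 C I S B) * card C"
      unfolding E_def by (rule card_extensions) (use less.prems in \<open>auto simp: avoiding_def\<close>)
    \<comment> \<open>A constraint whose scope misses \<open>u\<close> was already imposed on \<open>T - {u}\<close>, so a violated one has \<open>u\<close>
      in its scope.\<close>
    have sub: "E \<subseteq> avoiding T C I S B \<union> (\<Union>i\<in>J. X i)"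
    proof
      fix g assume g: "g \<in> E"
      show "g \<in> avoiding T C I S B \<union> (\<Union>i\<in>J. X i)"
      proof (cases "g \<in> avoiding T C I S B")
        case False
        then obtain i where i: "i \<in> I" "S i \<subseteq> T" "restrict g (S i) \<in> B i"
          using g by (auto simp: avoiding_def E_def)
        have "u \<in> S i"
        proof (rule ccontr)
          assume "u \<notin> S i"
          then have "S i \<subseteq> ?T0" using i by auto
          moreover from this have "restrict (restrict g ?T0) (S i) = restrict g (S i)"
            by (auto simp: restrict_def fun_eq_iff)
          ultimately show False using g i by (auto simp: E_def avoiding_def)
        qed
        moreover have "restrict g (T - S i) \<in> avoiding (T - S i) C I S B"
        proof -
          have "restrict (restrict g ?T0) (T - S i) \<in> avoiding (T - S i) C I S B"
            by (rule restrict_avoiding[where T = ?T0]) (use g \<open>u \<in> S i\<close> in \<open>auto simp: E_def\<close>)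
          moreover have "restrict (restrict g ?T0) (T - S i) = restrict g (T - S i)"
            using \<open>u \<in> S i\<close> by (auto simp: restrict_def fun_eq_iff)
          ultimately show ?thesis by simp
        qed
        ultimately show ?thesis using g i by (auto simp: X_def J_def E_def)
      qed auto
    qed
    have Xle: "real (card (X i)) \<le> a ?T0 * N / (2 * real D ^ 2)" if i: "i \<in> J" for i
    proof -
      have iI: "i \<in> I" "u \<in> S i" "S i \<subseteq> T" using i by (auto simp: J_def)
      have finS: "finite (S i)" using iI less.prems finite_subset by auto
      define m where "m = card (S i - {u})"
      have m: "card (S i) = Suc m" unfolding m_def using iI finS by (metis card_Suc_Diff1)
      have mD: "m \<le> D" using S[OF iI(1)] m by simp
      have finB: "finite (B i)"
        by (rule finite_subset[OF B[OF iI(1)] finite_PiE]) (use finS fin in auto)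
      have "real (card (X i)) \<le> a (T - S i) * real (card (B i))"
        unfolding a_def X_def of_nat_mult[symmetric] of_nat_le_iff
        using aT finB iI by (intro card_split_le) auto
      also have "T - S i = ?T0 - (S i - {u})" using iI by auto
      also have "a (?T0 - (S i - {u})) \<le> a ?T0 / \<beta> ^ m"
      proof -
        have "\<beta> ^ card (S i - {u}) * a (?T0 - (S i - {u})) \<le> a ?T0"
        proof (rule growth_iterate)
          fix T' v assume T': "T' \<subseteq> ?T0" "v \<in> T'"
          have "T' \<subset> T" using T' less.prems by auto
          then show "\<beta> * a (T' - {v}) \<le> a T'"
            using T' less.prems
            by (intro less.hyps) (auto intro: psubset_card_mono finite_subset)
        qed (use finS iI \<beta> in auto)
        then show ?thesis using \<beta> by (simp add: m_def field_simps)
      qed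
      also have "a ?T0 / \<beta> ^ m * real (card (B i))
          \<le> a ?T0 / \<beta> ^ m * (N ^ Suc m / (4 * real D ^ 2))"
        using few[OF iI(1)] \<beta> D m
        by (intro mult_left_mono) (auto simp: a_def N_def field_simps)
      also have "\<dots> = a ?T0 * N / (2 * real D ^ 2) * ((N / \<beta>) ^ m / 2)"
        using \<beta> by (simp add: power_divide field_simps)
      also have "\<dots> \<le> a ?T0 * N / (2 * real D ^ 2) * 1"
      proof (intro mult_left_mono)
        \<comment> \<open>Bernoulli's inequality bounds the loss over at most \<open>D\<close> steps by a factor 2.\<close>
        have "1 / 2 \<le> 1 + real m * (- 1 / (2 * real D))"
          using mD D by (simp add: field_simps)
        also have "\<dots> \<le> (1 + - 1 / (2 * real D)) ^ m"
          using D by (intro Bernoulli_inequality) (simp add: field_simps)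
        also have "\<dots> = (\<beta> / N) ^ m" using N by (simp add: \<beta>_def)
        finally have "1 / 2 \<le> (\<beta> / N) ^ m" .
        then show "(N / \<beta>) ^ m / 2 \<le> 1" using N \<beta> by (simp add: power_divide field_simps)
        show "0 \<le> a ?T0 * N / (2 * real D ^ 2)" using N by (simp add: a_def)
      qed
      finally show ?thesis by (simp add: mult_right_mono)
    qed
    have "card J \<le> card {i \<in> I. u \<in> S i}"
      using fin by (intro card_mono) (auto simp: J_def)
    also have "\<dots> \<le> D" using deg less.prems by auto
    finally have cardJ: "real (card J) \<le> real D" by simp
    have "N * a ?T0 = real (card E)" using cardE by (simp add: a_def N_def)
    also have "\<dots> \<le> real (card (avoiding T C I S B \<union> (\<Union>i\<in>J. X i)))"
      using aT[of T] finJ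
      by (intro of_nat_mono card_mono sub finite_UnI finite_UN_I finX) auto
    also have "\<dots> \<le> a T + real (\<Sum>i\<in>J. card (X i))"
      unfolding a_def of_nat_add[symmetric] of_nat_le_iff
      by (rule order_trans[OF card_Un_le add_left_mono[OF card_UN_le[OF finJ]]])
    also have "real (\<Sum>i\<in>J. card (X i)) \<le> real (card J) * (a ?T0 * N / (2 * real D ^ 2))"
      using sum_bounded_above[of J "\<lambda>i. real (card (X i))", OF Xle] by simp
    also have "\<dots> \<le> real D * (a ?T0 * N / (2 * real D ^ 2))"
      using N cardJ by (intro mult_right_mono) (auto simp: a_def)
    also have "\<dots> = N * a ?T0 / (2 * real D)" using D by (simp add: power2_eq_square)
    finally show ?case by (simp add: \<beta>_def algebra_simps)
  qed
qed

text \<open>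
  A form of the symmetric Lovasz local lemma: each forbidden event has probability at most
  \<open>1 / (4 D\<^sup>2)\<close> and shares variables with at most \<open>D\<^sup>2\<close> events, itself included. Multiplying the growth
  factors shows that an avoiding assignment exists.
\<close>

lemma avoiding_nonempty:
  fixes D :: nat
  assumes fin: "finite V" "finite C" "finite I" and C: "C \<noteq> {}"
    and S: "\<And>i. i \<in> I \<Longrightarrow> S i \<noteq> {} \<and> card (S i) \<le> D"
    and deg: "\<And>v. v \<in> V \<Longrightarrow> card {i \<in> I. v \<in> S i} \<le> D"
    and B: "\<And>i. i \<in> I \<Longrightarrow> B i \<subseteq> S i \<rightarrow>\<^sub>E C"
    and few: "\<And>i. i \<in> I \<Longrightarrow> 4 * real D ^ 2 * real (card (B i)) \<le> real (card C) ^ card (S i)"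
    and D: "D > 0"
  shows "avoiding V C I S B \<noteq> {}"
proof -
  define \<beta> where "\<beta> = (1 - 1 / (2 * real D)) * real (card C)"
  have \<beta>: "\<beta> > 0" using C fin D by (simp add: \<beta>_def field_simps card_gt_0_iff)
  have "avoiding {} C I S B = {\<lambda>_. undefined}"
    using S by (auto simp: avoiding_def)
  moreover have "\<beta> ^ card V * real (card (avoiding (V - V) C I S B))
      \<le> real (card (avoiding V C I S B))"
  proof (rule growth_iterate)
    fix T u assume "T \<subseteq> V" "u \<in> T"
    then show "\<beta> * real (card (avoiding (T - {u}) C I S B)) \<le> real (card (avoiding T C I S B))"
      unfolding \<beta>_def using S by (intro avoiding_growth[where V = V] fin C deg B few D) auto
  qed (use fin \<beta> in auto)
  ultimately have "\<beta> ^ card V \<le> real (card (avoiding V C I S B))" by simp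
  moreover have "\<beta> ^ card V > 0" using \<beta> by simp
  ultimately show ?thesis by auto
qed



section \<open>Sublists that no small set of colors can hit\<close>

text \<open>
  \<open>P J\<close> is \<open>A\<close> without the blocks of size \<open>w\<close> whose indices lie in \<open>J\<close>. Deleting the at most \<open>s\<close> blocks that
  meet \<open>R\<close> shows the last property. The point of using blocks is that the number of options is bounded
  in terms of \<open>b\<close> and \<open>s\<close>, independently of the size of \<open>A\<close>.
\<close>

lemma block_removals:
  fixes A :: "'c set"
  assumes fin: "finite A" and blocks: "card A \<le> b * w" and size: "c + s * w \<le> card A"
  obtains P where "\<And>J. J \<subseteq> {..<b} \<Longrightarrow> P J \<subseteq> A"
    and "\<And>J. J \<subseteq> {..<b} \<Longrightarrow> card J \<le> s \<Longrightarrow> c \<le> card (P J)"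
    and "\<And>R. finite R \<Longrightarrow> card R \<le> s \<Longrightarrow> \<exists>J. J \<subseteq> {..<b} \<and> card J \<le> s \<and> P J \<inter> R = {}"
proof -
  obtain e where e: "bij_betw e A {..<card A}"
    using ex_bij_betw_finite_nat[OF fin] by (auto simp: atLeast0LessThan)
  have lt: "e x div w < b" if "x \<in> A" for x
  proof -
    have "e x < b * w" using bij_betwE[OF e] that blocks by fastforce
    then show ?thesis using less_mult_imp_div_less by blast
  qed
  have fibre: "card {x \<in> A. e x div w = j} \<le> w" for j
  proof (cases "w = 0")
    case True
    then show ?thesis using blocks fin by simp
  next
    case False
    have "e ` {x \<in> A. e x div w = j} \<subseteq> {j * w..<j * w + w}"
      using False dividend_less_times_div[of w] by (auto simp: mult.commute add.commute)
    moreover have "inj_on e {x \<in> A. e x div w = j}"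
      using e by (auto simp: bij_betw_def inj_on_def)
    ultimately have "card {x \<in> A. e x div w = j} \<le> card {j * w..<j * w + w}"
      by (intro card_inj_on_le) auto
    then show ?thesis by simp
  qed
  \<comment> \<open>The block of \<open>x\<close> is \<open>e x div w\<close>, for an enumeration \<open>e\<close> of \<open>A\<close>.\<close>
  define P where "P J = {x \<in> A. e x div w \<notin> J}" for J
  show thesis
  proof
    show "P J \<subseteq> A" for J by (auto simp: P_def)
    show "c \<le> card (P J)" if J: "J \<subseteq> {..<b}" "card J \<le> s" for J
    proof -
      have finJ: "finite J" using J finite_subset by blast
      have "A = P J \<union> (\<Union>j\<in>J. {x \<in> A. e x div w = j})" by (auto simp: P_def)
      then have "card A \<le> card (P J) + card (\<Union>j\<in>J. {x \<in> A. e x div w = j})"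
        using card_Un_le by metis
      also have "card (\<Union>j\<in>J. {x \<in> A. e x div w = j}) \<le> (\<Sum>j\<in>J. card {x \<in> A. e x div w = j})"
        by (rule card_UN_le[OF finJ])
      also have "\<dots> \<le> card J * w"
        using sum_bounded_above[of J "\<lambda>j. card {x \<in> A. e x div w = j}" w] fibre by simp
      also have "\<dots> \<le> s * w" using J by simp
      finally show ?thesis using size by simp
    qed
    show "\<exists>J. J \<subseteq> {..<b} \<and> card J \<le> s \<and> P J \<inter> R = {}" if R: "finite R" "card R \<le> s" for R
    proof (intro exI conjI)
      show "(\<lambda>x. e x div w) ` (A \<inter> R) \<subseteq> {..<b}" using lt by auto
      have "card ((\<lambda>x. e x div w) ` (A \<inter> R)) \<le> card (A \<inter> R)" using R by (intro card_image_le) auto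
      also have "\<dots> \<le> card R" using R by (intro card_mono) auto
      finally show "card ((\<lambda>x. e x div w) ` (A \<inter> R)) \<le> s" using R by simp
      show "P ((\<lambda>x. e x div w) ` (A \<inter> R)) \<inter> R = {}" by (auto simp: P_def)
    qed
  qed
qed

text \<open>
  Used to count the sets of at most \<open>s\<close> colors by the lists of length exactly \<open>s\<close>.
\<close>

lemma list_enumerating_set:
  assumes "finite R" "R \<noteq> {}" "card R \<le> s"
  obtains xs where "set xs = R" "length xs = s"
proof -
  obtain ys where ys: "set ys = R" "distinct ys" using finite_distinct_list[OF assms(1)] by auto
  obtain y where "y \<in> R" using assms by auto
  have "length ys = card R" using ys distinct_card by metis
  then have "set (ys @ replicate (s - card R) y) = R" "length (ys @ replicate (s - card R) y) = s"
    using ys \<open>y \<in> R\<close> assms by auto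
  then show thesis using that by blast
qed

text \<open>
  The local lemma is applied with one constraint for each \<open>i\<close>: its forbidden patterns are the choices
  on \<open>S i\<close> for which some set of at most \<open>s\<close> colors hits all chosen sets. Only colors from
  the lists of \<open>S i\<close> matter, so there are at most \<open>(D t) ^ s\<close> such sets to consider, and for a fixed one
  at least one of the options at each point fails to be hit.
\<close>

lemma exists_unhit_choice:
  fixes P :: "'v \<Rightarrow> 'j \<Rightarrow> 'c set"
  assumes fin: "finite V" "finite C" "finite I"
    and S: "\<And>i. i \<in> I \<Longrightarrow> S i \<subseteq> V \<and> S i \<noteq> {} \<and> card (S i) \<le> D"
    and deg: "\<And>v. v \<in> V \<Longrightarrow> card {i \<in> I. v \<in> S i} \<le> D"
    and L: "\<And>v. v \<in> V \<Longrightarrow> finite (L v) \<and> card (L v) \<le> t"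
    and P: "\<And>v J. v \<in> V \<Longrightarrow> J \<in> C \<Longrightarrow> P v J \<subseteq> L v"
    and avoid: "\<And>v R. v \<in> V \<Longrightarrow> finite R \<Longrightarrow> card R \<le> s \<Longrightarrow> \<exists>J\<in>C. P v J \<inter> R = {}"
    and few: "\<And>i. i \<in> I \<Longrightarrow> 4 * real D ^ 2 * real (D * t) ^ s * real (card C - 1) ^ card (S i)
        \<le> real (card C) ^ card (S i)"
    and C: "C \<noteq> {}" and D: "D > 0"
  obtains g where "\<And>v. v \<in> V \<Longrightarrow> g v \<in> C"
    and "\<And>i R. i \<in> I \<Longrightarrow> finite R \<Longrightarrow> card R \<le> s \<Longrightarrow> \<exists>v\<in>S i. P v (g v) \<inter> R = {}"
proof -
  define U where "U i = (\<Union>v\<in>S i. L v)" for i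
  define hit where "hit v R = {J \<in> C. P v J \<inter> R \<noteq> {}}" for v R
  define B where "B i = (\<Union>xs\<in>{xs. set xs \<subseteq> U i \<and> length xs = s}. \<Pi>\<^sub>E v\<in>S i. hit v (set xs))" for i
  have finS: "finite (S i)" if "i \<in> I" for i using S[OF that] fin finite_subset by auto
  have finU: "finite (U i)" if "i \<in> I" for i using S[OF that] L finS[OF that] by (auto simp: U_def)
  have cardU: "card (U i) \<le> D * t" if i: "i \<in> I" for i
  proof -
    have "card (U i) \<le> (\<Sum>v\<in>S i. card (L v))" unfolding U_def by (rule card_UN_le[OF finS[OF i]])
    also have "\<dots> \<le> card (S i) * t"
      using sum_bounded_above[of "S i" "\<lambda>v. card (L v)" t] S[OF i] L by auto
    also have "\<dots> \<le> D * t" using S[OF i] by simp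
    finally show ?thesis .
  qed
  have hit_le: "card (hit v (set xs)) \<le> card C - 1" if v: "v \<in> V" and xs: "length xs = s" for v and xs :: "'c list"
  proof -
    have "card (set xs) \<le> s" using card_length[of xs] xs by simp
    then obtain J where J: "J \<in> C" "P v J \<inter> set xs = {}" using avoid[OF v] by auto
    have "hit v (set xs) \<subseteq> C - {J}" using J by (auto simp: hit_def)
    then have "card (hit v (set xs)) \<le> card (C - {J})" using fin by (intro card_mono) auto
    then show ?thesis using J fin by simp
  qed
  have cardB: "card (B i) \<le> (D * t) ^ s * (card C - 1) ^ card (S i)" if i: "i \<in> I" for i
  proof -
    let ?X = "{xs. set xs \<subseteq> U i \<and> length xs = s}"
    have finX: "finite ?X" using finite_lists_length_eq[OF finU[OF i]] .
    have "card (B i) \<le> (\<Sum>xs\<in>?X. card (\<Pi>\<^sub>E v\<in>S i. hit v (set xs)))"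
      unfolding B_def by (rule card_UN_le[OF finX])
    also have "\<dots> \<le> card ?X * (card C - 1) ^ card (S i)"
    proof -
      have "card (\<Pi>\<^sub>E v\<in>S i. hit v (set xs)) \<le> (card C - 1) ^ card (S i)" if "xs \<in> ?X" for xs
      proof -
        have "card (\<Pi>\<^sub>E v\<in>S i. hit v (set xs)) = (\<Prod>v\<in>S i. card (hit v (set xs)))"
          by (rule card_PiE[OF finS[OF i]])
        also have "\<dots> \<le> (\<Prod>v\<in>S i. card C - 1)"
          using that hit_le S[OF i] by (intro prod_mono) auto
        finally show ?thesis by simp
      qed
      from sum_bounded_above[of ?X, OF this] show ?thesis by simp
    qed
    also have "card ?X = card (U i) ^ s" using card_lists_length_eq[OF finU[OF i]] .
    finally show ?thesis
      using mult_le_mono1[OF power_mono[OF cardU[OF i], of s]] order_trans by blast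
  qed
  have "avoiding V C I S B \<noteq> {}"
  proof (rule avoiding_nonempty[where D = D])
    show "B i \<subseteq> S i \<rightarrow>\<^sub>E C" if "i \<in> I" for i by (auto simp: B_def hit_def PiE_iff)
    show "4 * real D ^ 2 * real (card (B i)) \<le> real (card C) ^ card (S i)" if i: "i \<in> I" for i
    proof -
      have "4 * real D ^ 2 * real (card (B i))
          \<le> 4 * real D ^ 2 * real ((D * t) ^ s * (card C - 1) ^ card (S i))"
        using cardB[OF i] by (intro mult_left_mono of_nat_mono) auto
      then show ?thesis using few[OF i] by (simp add: mult.assoc)
    qed
  qed (use fin C D S deg in auto)
  then obtain g where g: "g \<in> V \<rightarrow>\<^sub>E C" "\<And>i. i \<in> I \<Longrightarrow> restrict g (S i) \<notin> B i"
    using S by (fastforce simp: avoiding_def)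
  show thesis
  proof
    show "g v \<in> C" if "v \<in> V" for v using g that by auto
    show "\<exists>v\<in>S i. P v (g v) \<inter> R = {}" if i: "i \<in> I" and R: "finite R" "card R \<le> s" for i R
    proof (rule ccontr)
      assume "\<not> (\<exists>v\<in>S i. P v (g v) \<inter> R = {})"
      then have meets: "P v (g v) \<inter> R \<noteq> {}" if "v \<in> S i" for v using that by blast
      have PU: "P v (g v) \<subseteq> U i" if "v \<in> S i" for v
        using that S[OF i] P g(1) unfolding U_def by blast
      have ne: "R \<inter> U i \<noteq> {}" using S[OF i] meets PU by blast
      have "card (R \<inter> U i) \<le> s" using R card_mono[of R "R \<inter> U i"] by simp
      then obtain xs where xs: "set xs = R \<inter> U i" "length xs = s"
        using list_enumerating_set[of "R \<inter> U i" s] R ne by auto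
      have "restrict g (S i) \<in> (\<Pi>\<^sub>E v\<in>S i. hit v (set xs))"
        using meets PU S[OF i] g(1) by (fastforce simp: hit_def xs)
      moreover have "xs \<in> {xs. set xs \<subseteq> U i \<and> length xs = s}" using xs by simp
      ultimately have "restrict g (S i) \<in> B i" unfolding B_def by blast
      then show False using g(2)[OF i] by simp
    qed
  qed
qed

section \<open>Neighborhoods, degrees and greedy coloring\<close>

lemma finite_neighbors:
  assumes "pair_graph G"
  shows "finite (neighbors G v)"
proof -
  interpret pair_graph G by fact
  have "neighbors G v \<subseteq> snd ` parcs G" by (force simp: neighbors_def)
  then show ?thesis using pair_finite_arcs finite_subset by blast
qed

lemma neighbors_subset_verts:
  assumes "pair_graph G"
  shows "neighbors G v \<subseteq> pverts G"
proof -
  interpret pair_graph G by fact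
  show ?thesis using in_arcsD2 by (auto simp: neighbors_def)
qed

lemma finite_pverts:
  assumes "pair_graph G"
  shows "finite (pverts G)"
proof -
  interpret pair_graph G by fact
  show ?thesis by (rule pair_finite_verts)
qed

lemma neighbors_sym:
  assumes "pair_graph G"
  shows "w \<in> neighbors G v \<longleftrightarrow> v \<in> neighbors G w"
proof -
  interpret pair_graph G by fact
  have "sym (parcs G)" using pair_sym_arcs by (simp add: symmetric_def)
  then show ?thesis by (auto simp: neighbors_def sym_def)
qed

lemma not_self_neighbor:
  assumes "pair_graph G"
  shows "v \<notin> neighbors G v"
proof -
  interpret pair_graph G by fact
  show ?thesis using pair_no_loops[of "(v, v)"] by (auto simp: neighbors_def)
qed

lemma proper_coloring_iff_neighbors:
  assumes "pair_graph G"
  shows "proper_coloring G f \<longleftrightarrow> (\<forall>v\<in>pverts G. \<forall>w\<in>neighbors G v. f v \<noteq> f w)"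
proof -
  interpret pair_graph G by fact
  show ?thesis using in_arcsD1 by (auto simp: proper_coloring_def neighbors_def)
qed

lemma degree_le_max_degree: "pair_graph G \<Longrightarrow> v \<in> pverts G \<Longrightarrow> degree G v \<le> max_degree G"
  by (simp add: max_degree_def finite_pverts)

lemma min_degree_le_degree: "pair_graph G \<Longrightarrow> v \<in> pverts G \<Longrightarrow> min_degree G \<le> degree G v"
  by (simp add: min_degree_def finite_pverts)

text \<open>Greedy coloring: at most \<open>\<Delta>\<close> colors are excluded when a vertex is reached.\<close>

lemma choosable_Suc_max_degree:
  assumes G: "pair_graph G"
  shows "choosable G (Suc (max_degree G))"
  unfolding choosable_def
proof (intro allI impI)
  fix L assume L: "list_assignment G (Suc (max_degree G)) L"
  have "\<exists>f. \<forall>v\<in>S. f v \<in> L v \<and> (\<forall>w\<in>S \<inter> neighbors G v. f v \<noteq> f w)"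
    if "finite S" "S \<subseteq> pverts G" for S
    using that
  proof (induction S rule: finite_induct)
    case (insert x S)
    then obtain f where f: "\<forall>v\<in>S. f v \<in> L v \<and> (\<forall>w\<in>S \<inter> neighbors G v. f v \<noteq> f w)" by auto
    have x: "x \<in> pverts G" using insert by simp
    have "card (f ` neighbors G x) \<le> degree G x"
      unfolding degree_def by (intro card_image_le finite_neighbors G)
    also have "\<dots> < Suc (max_degree G)" using degree_le_max_degree[OF G x] by simp
    finally have "\<not> L x \<subseteq> f ` neighbors G x"
      using L x finite_neighbors[OF G, of x] card_mono[of "f ` neighbors G x" "L x"]
        finite_subset[of "L x" "f ` neighbors G x"]
      by (fastforce simp: list_assignment_def)
    then obtain c where c: "c \<in> L x" "c \<notin> f ` neighbors G x" by auto
    have "\<forall>v\<in>insert x S. (f(x := c)) v \<in> L v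
        \<and> (\<forall>w\<in>insert x S \<inter> neighbors G v. (f(x := c)) v \<noteq> (f(x := c)) w)"
      using f c insert.hyps not_self_neighbor[OF G, of x] neighbors_sym[OF G] by auto
    then show ?case by blast
  qed simp
  from this[OF finite_pverts[OF G] subset_refl]
  obtain f where "\<forall>v\<in>pverts G. f v \<in> L v \<and> (\<forall>w\<in>pverts G \<inter> neighbors G v. f v \<noteq> f w)" by blast
  then show "\<exists>f. proper_coloring G f \<and> (\<forall>v\<in>pverts G. f v \<in> L v)"
    using neighbors_subset_verts[OF G] unfolding proper_coloring_iff_neighbors[OF G] by blast
qed

lemma choosable_choice_number: "pair_graph G \<Longrightarrow> choosable G (choice_number G)"
  unfolding choice_number_def by (rule LeastI, rule choosable_Suc_max_degree)

lemma choice_number_le: "pair_graph G \<Longrightarrow> choice_number G \<le> Suc (max_degree G)"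
  unfolding choice_number_def by (rule Least_le, rule choosable_Suc_max_degree)

section \<open>Dynamic colorings from sublists\<close>

text \<open>
  The neighborhoods are the scopes of the constraints; each has at most \<open>\<Delta>\<close> vertices, and each vertex
  lies in at most \<open>\<Delta>\<close> of them. Once no set of at most \<open>s\<close> colors hits all sublists around a vertex \<open>v\<close>,
  the set of colors appearing around \<open>v\<close> has more than \<open>s\<close> elements, because it does hit all of them.
\<close>

lemma dynamic_choosable_of_choosable:
  fixes G :: "'a pair_pre_digraph" and b w c s t :: nat
  defines "N \<equiv> card {J. J \<subseteq> {..<b} \<and> card J \<le> s}"
  assumes G: "pair_graph G" and choos: "choosable G c" and pos: "min_degree G > 0"
    and t: "t \<le> b * w" "c + s * w \<le> t"
    and few: "\<And>v. v \<in> pverts G \<Longrightarrow>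
      4 * real (max_degree G) ^ 2 * real (max_degree G * t) ^ s * real (N - 1) ^ degree G v
        \<le> real N ^ degree G v"
  shows "dynamic_choosable (Suc s) G t"
  unfolding dynamic_choosable_def
proof (intro allI impI)
  fix L assume L: "list_assignment G t L"
  show "\<exists>f. dynamic_coloring (Suc s) G f \<and> (\<forall>v\<in>pverts G. f v \<in> L v)"
  \<comment> \<open>The minimum degree of the graph without vertices is unspecified.\<close>
  proof (cases "pverts G = {}")
    case True
    then show ?thesis
      by (auto simp: dynamic_coloring_def proper_coloring_iff_neighbors[OF G])
  next
    case False
    then obtain v\<^sub>0 where v0: "v\<^sub>0 \<in> pverts G" by auto
    define D where "D = max_degree G"
    have D: "D > 0"
      using min_degree_le_degree[OF G v0] degree_le_max_degree[OF G v0] pos by (simp add: D_def)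
    have "\<exists>A \<subseteq> L v. finite A \<and> card A = t" if "v \<in> pverts G" for v
      using L that infinite_arbitrarily_large[of "L v" t] obtain_subset_with_card_n[of t "L v"]
        card.infinite unfolding list_assignment_def by metis
    then obtain L' where L': "\<And>v. v \<in> pverts G \<Longrightarrow> L' v \<subseteq> L v \<and> finite (L' v) \<and> card (L' v) = t"
      by metis
    define C where "C = {J. J \<subseteq> {..<b} \<and> card J \<le> s}"
    have "\<exists>P. (\<forall>J. J \<subseteq> {..<b} \<longrightarrow> P J \<subseteq> L' v)
        \<and> (\<forall>J. J \<subseteq> {..<b} \<longrightarrow> card J \<le> s \<longrightarrow> c \<le> card (P J))
        \<and> (\<forall>R. finite R \<longrightarrow> card R \<le> s \<longrightarrow> (\<exists>J. J \<subseteq> {..<b} \<and> card J \<le> s \<and> P J \<inter> R = {}))"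
      if v: "v \<in> pverts G" for v
      by (rule block_removals[of "L' v" b w c s]) (use L'[OF v] t in \<open>auto 4 4\<close>)
    then obtain P where P: "\<And>v J. v \<in> pverts G \<Longrightarrow> J \<in> C \<Longrightarrow> P v J \<subseteq> L' v \<and> c \<le> card (P v J)"
      and avoid: "\<And>v R. v \<in> pverts G \<Longrightarrow> finite R \<Longrightarrow> card R \<le> s \<Longrightarrow> \<exists>J\<in>C. P v J \<inter> R = {}"
      unfolding C_def by simp metis
    obtain g where g: "\<And>v. v \<in> pverts G \<Longrightarrow> g v \<in> C"
      and unhit: "\<And>v R. v \<in> pverts G \<Longrightarrow> finite R \<Longrightarrow> card R \<le> s
        \<Longrightarrow> \<exists>u\<in>neighbors G v. P u (g u) \<inter> R = {}"
    proof (rule exists_unhit_choice[of "pverts G" C "pverts G" "neighbors G" D L' t P s])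
      show "neighbors G v \<subseteq> pverts G \<and> neighbors G v \<noteq> {} \<and> card (neighbors G v) \<le> D"
        if "v \<in> pverts G" for v
        using neighbors_subset_verts[OF G] degree_le_max_degree[OF G that]
          min_degree_le_degree[OF G that] pos by (auto simp: degree_def D_def)
      show "card {v \<in> pverts G. u \<in> neighbors G v} \<le> D" if "u \<in> pverts G" for u
      proof -
        have "{v \<in> pverts G. u \<in> neighbors G v} = neighbors G u"
          using neighbors_sym[OF G] neighbors_subset_verts[OF G] by auto
        then show ?thesis using degree_le_max_degree[OF G that] by (simp add: degree_def D_def)
      qed
      show "4 * real D ^ 2 * real (D * t) ^ s * real (card C - 1) ^ card (neighbors G v)
          \<le> real (card C) ^ card (neighbors G v)" if "v \<in> pverts G" for v
        using few[OF that] by (simp only: D_def C_def N_def degree_def)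
      show "C \<noteq> {}" by (auto simp: C_def intro: exI[of _ "{}"])
      show "finite C" by (simp add: C_def)
    qed (use finite_pverts[OF G] L' P avoid D in auto)
    define K where "K v = P v (g v)" for v
    have K: "K v \<subseteq> L v" "finite (K v)" "c \<le> card (K v)" if "v \<in> pverts G" for v
      using P[OF that g[OF that]] L'[OF that] finite_subset by (auto simp: K_def)
    then have "list_assignment G c K" by (auto simp: list_assignment_def)
    then obtain f where f: "proper_coloring G f" "\<And>v. v \<in> pverts G \<Longrightarrow> f v \<in> K v"
      using choos unfolding choosable_def by blast
    have "Suc s \<le> card (f ` neighbors G v)" if v: "v \<in> pverts G" for v
    proof (rule ccontr)
      assume "\<not> ?thesis"
      then obtain u where "u \<in> neighbors G v" "K u \<inter> f ` neighbors G v = {}"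
        using unhit[OF v, of "f ` neighbors G v"] finite_neighbors[OF G] by (auto simp: K_def)
      moreover from this have "f u \<in> K u" using f(2) neighbors_subset_verts[OF G] by auto
      ultimately show False by auto
    qed
    then have "dynamic_coloring (Suc s) G f" using f(1)
      by (auto simp: dynamic_coloring_def intro: min.coboundedI1)
    then show ?thesis using f(2) K(1) by blast
  qed
qed

text \<open>
  Since \<open>(1 - 1 / N) ^ d \<le> exp (- d / N) \<le> exp (- x / (k N))\<close>, the left-hand side divided by \<open>N ^ d\<close> is
  at most a polynomial in \<open>x\<close> times a decaying exponential.
\<close>

lemma eventually_exponential_dominates:
  fixes K N k :: real
  assumes "N \<ge> 1" "k > 0"
  shows "\<forall>\<^sub>F x in sequentially. \<forall>d. real x \<le> k * real d \<longrightarrow>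
    4 * real x ^ 2 * (K * real x ^ 2) ^ s * (N - 1) ^ d \<le> N ^ d"
proof -
  define \<alpha> where "\<alpha> = 1 / (k * N)"
  have \<alpha>: "\<alpha> > 0" using assms by (simp add: \<alpha>_def)
  define p where "p = 2 + 2 * s"
  have "((\<lambda>y::real. y ^ p / exp y) \<longlongrightarrow> 0) at_top" by (rule tendsto_power_div_exp_0)
  moreover have "filterlim (\<lambda>x. \<alpha> * real x) at_top sequentially"
    by (rule filterlim_tendsto_pos_mult_at_top[OF tendsto_const \<alpha> filterlim_real_sequentially])
  ultimately have "(\<lambda>x. (\<alpha> * real x) ^ p / exp (\<alpha> * real x)) \<longlonglongrightarrow> 0"
    by (rule filterlim_compose)
  then have "(\<lambda>x. 4 * K ^ s / \<alpha> ^ p * ((\<alpha> * real x) ^ p / exp (\<alpha> * real x))) \<longlonglongrightarrow> 4 * K ^ s / \<alpha> ^ p * 0"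
    by (intro tendsto_mult_left)
  then have "\<forall>\<^sub>F x in sequentially. 4 * K ^ s / \<alpha> ^ p * ((\<alpha> * real x) ^ p / exp (\<alpha> * real x)) < 1"
    by (rule order_tendstoD(2)) simp
  then show ?thesis
  proof eventually_elim
    case (elim x)
    show ?case
    proof (intro allI impI)
      fix d assume d: "real x \<le> k * real d"
      have "4 * real x ^ 2 * (K * real x ^ 2) ^ s = 4 * K ^ s / \<alpha> ^ p * (\<alpha> * real x) ^ p"
        using \<alpha> by (simp add: p_def power_mult_distrib power_add power_mult power2_eq_square)
      also have "\<dots> \<le> exp (\<alpha> * real x)" using elim by (simp add: field_simps)
      finally have poly: "4 * real x ^ 2 * (K * real x ^ 2) ^ s \<le> exp (\<alpha> * real x)" .
      have "\<alpha> * real x \<le> real d / N" using d assms by (simp add: \<alpha>_def field_simps)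
      have "(N - 1) / N \<le> exp (- (1 / N))"
        using exp_ge_add_one_self[of "- (1 / N)"] assms by (simp add: field_simps)
      then have "((N - 1) / N) ^ d \<le> exp (- (1 / N)) ^ d"
        using assms by (intro power_mono) auto
      also have "\<dots> = exp (- (real d / N))" by (simp flip: exp_of_nat_mult)
      also have "\<dots> \<le> exp (- (\<alpha> * real x))" using \<open>\<alpha> * real x \<le> real d / N\<close> by simp
      finally have "(N - 1) ^ d \<le> N ^ d * exp (- (\<alpha> * real x))"
        using assms by (simp add: power_divide field_simps)
      then have "4 * real x ^ 2 * (K * real x ^ 2) ^ s * (N - 1) ^ d
          \<le> exp (\<alpha> * real x) * (N ^ d * exp (- (\<alpha> * real x)))"
        using poly assms by (intro mult_mono) auto
      also have "\<dots> = N ^ d" by (simp add: exp_minus field_simps)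
      finally show "4 * real x ^ 2 * (K * real x ^ 2) ^ s * (N - 1) ^ d \<le> N ^ d" .
    qed
  qed
qed
section \<open>Comparing the dynamic choice number with the choice number\<close>

theorem corollary4p1:
  fixes \<epsilon> k :: real and r :: nat
  assumes "\<epsilon> > 0" and "r \<ge> 2" and "k \<ge> 1"
  shows "\<exists>l\<^sub>0 :: nat. \<forall>G :: 'a pair_pre_digraph.
    pair_graph G \<longrightarrow>
    min_degree G > 0 \<longrightarrow>
    real (max_degree G) / real (min_degree G) \<le> k \<longrightarrow>
    choice_number G \<ge> l\<^sub>0 \<longrightarrow>
    real (dynamic_choice_number r G) \<le> (1 + \<epsilon>) * real (choice_number G)"
proof -
  define s where "s = r - 1"
  have r: "r = Suc s" using assms(2) by (simp add: s_def)
  \<comment> \<open>A list of size \<open>t = \<lfloor>(1 + \<epsilon>) c\<rfloor>\<close> is cut into blocks of size \<open>w \<approx> \<epsilon> c / r\<close>. Deleting \<open>r - 1\<close> of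
    them costs less than \<open>\<epsilon> c\<close> colors, and about \<open>r (1 + \<epsilon>) / \<epsilon>\<close> blocks suffice; the factor 2 in
    \<open>b\<close> absorbs the rounding of \<open>w\<close>. It is essential that \<open>b\<close>, and hence \<open>N\<close>, does not depend on
    the graph.\<close>
  define b where "b = nat \<lceil>2 * real r * (1 + \<epsilon>) / \<epsilon>\<rceil>"
  have b: "2 * real r * (1 + \<epsilon>) / \<epsilon> \<le> real b" unfolding b_def by (rule real_nat_ceiling_ge)
  define N where "N = card {J. J \<subseteq> {..<b} \<and> card J \<le> s}"
  have "finite {J. J \<subseteq> {..<b} \<and> card J \<le> s}" by simp
  moreover have "{} \<in> {J. J \<subseteq> {..<b} \<and> card J \<le> s}" by simp
  ultimately have "N > 0" unfolding N_def card_gt_0_iff by blast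
  then have N: "N \<ge> 1" by simp
  \<comment> \<open>\<open>t \<le> K \<Delta>\<close> will hold, because \<open>c \<le> \<Delta> + 1 \<le> 2 \<Delta>\<close>.\<close>
  define K where "K = 2 * (1 + \<epsilon>)"
  obtain x\<^sub>0 where x0: "\<And>x d. x \<ge> x\<^sub>0 \<Longrightarrow> real x \<le> k * real d \<Longrightarrow>
      4 * real x ^ 2 * (K * real x ^ 2) ^ s * (real N - 1) ^ d \<le> real N ^ d"
    using eventually_exponential_dominates[of "real N" k K s] N assms
    unfolding eventually_sequentially by auto
  \<comment> \<open>The first summand forces \<open>\<Delta> \<ge> c - 1 > x\<^sub>0\<close>, the second forces \<open>\<epsilon> c \<ge> 2 r\<close>, so that \<open>w \<ge> 1\<close> and
    the rounding of \<open>t\<close> and \<open>w\<close> does no harm.\<close>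
  define l where "l = Suc (Suc x\<^sub>0) + nat \<lceil>2 * real r / \<epsilon>\<rceil>"
  show ?thesis
  proof (intro exI[of _ l] allI impI)
    fix G :: "'a pair_pre_digraph"
    assume G: "pair_graph G" and pos: "min_degree G > 0"
      and ratio: "real (max_degree G) / real (min_degree G) \<le> k"
      and large: "l \<le> choice_number G"
    define c where "c = choice_number G"
    define D where "D = max_degree G"
    have c: "c \<ge> Suc (Suc x\<^sub>0)" "real c \<ge> 2 * real r / \<epsilon>"
      using large by (auto simp: l_def c_def) linarith
    then have \<epsilon>c: "\<epsilon> * real c \<ge> 2 * real r" using assms by (simp add: field_simps)
    have cD: "c \<le> Suc D" unfolding c_def D_def by (rule choice_number_le[OF G])
    define t where "t = nat \<lfloor>(1 + \<epsilon>) * real c\<rfloor>"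
    define w where "w = nat \<lfloor>\<epsilon> * real c / real r\<rfloor>"
    have t: "real t \<le> (1 + \<epsilon>) * real c" "(1 + \<epsilon>) * real c < real t + 1"
      using assms by (auto simp: t_def)
    have w: "real w \<le> \<epsilon> * real c / real r" "\<epsilon> * real c / real r < real w + 1"
      using assms by (auto simp: w_def)
    have "dynamic_choosable (Suc s) G t"
    proof (rule dynamic_choosable_of_choosable[OF G _ pos, where c = c and b = b and w = w])
      show "choosable G c" unfolding c_def by (rule choosable_choice_number[OF G])
      have "1 \<le> \<epsilon> * real c / (2 * real r)" using \<epsilon>c r by (simp add: field_simps)
      then have w2: "\<epsilon> * real c / (2 * real r) \<le> real w" using w by (simp add: field_simps)
      have "real t \<le> (2 * real r * (1 + \<epsilon>) / \<epsilon>) * (\<epsilon> * real c / (2 * real r))"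
        using t r assms by simp
      also have "\<dots> \<le> real b * real w"
        using assms by (intro mult_mono b w2) auto
      finally show "t \<le> b * w" by (simp flip: of_nat_mult)
      have "real s * real w \<le> real s * (\<epsilon> * real c / real r)"
        using w by (intro mult_left_mono) auto
      also have "\<dots> = \<epsilon> * real c - \<epsilon> * real c / real r" by (simp add: r field_simps)
      also have "\<dots> \<le> \<epsilon> * real c - 1" using \<epsilon>c r by (simp add: field_simps)
      finally have "real (c + s * w) < real t + 1" using t by (simp add: algebra_simps)
      then show "c + s * w \<le> t" by linarith
      fix v assume v: "v \<in> pverts G"
      have "real D \<le> k * real (min_degree G)" using ratio pos by (simp add: D_def field_simps)
      also have "\<dots> \<le> k * real (degree G v)"
        using min_degree_le_degree[OF G v] assms by (intro mult_left_mono) auto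
      finally have "4 * real D ^ 2 * (K * real D ^ 2) ^ s * (real N - 1) ^ degree G v
          \<le> real N ^ degree G v"
        using c cD by (intro x0) auto
      moreover have "real (D * t) \<le> K * real D ^ 2"
      proof -
        have "real c \<le> 2 * real D" using c cD by linarith
        then have "(1 + \<epsilon>) * real c \<le> (1 + \<epsilon>) * (2 * real D)"
          using assms by (intro mult_left_mono) auto
        then have "real t \<le> K * real D" using order_trans[OF t(1)] by (simp add: K_def algebra_simps)
        then have "real D * real t \<le> real D * (K * real D)" by (intro mult_left_mono) auto
        then show ?thesis by (simp add: power2_eq_square algebra_simps)
      qed
      then have "4 * real D ^ 2 * real (D * t) ^ s * (real N - 1) ^ degree G v
          \<le> 4 * real D ^ 2 * (K * real D ^ 2) ^ s * (real N - 1) ^ degree G v"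
        using N by (intro mult_right_mono mult_left_mono power_mono) auto
      ultimately show "4 * real (max_degree G) ^ 2 * real (max_degree G * t) ^ s
          * real (card {J. J \<subseteq> {..<b} \<and> card J \<le> s} - 1) ^ degree G v
          \<le> real (card {J. J \<subseteq> {..<b} \<and> card J \<le> s}) ^ degree G v"
        unfolding D_def[symmetric] N_def[symmetric] of_nat_diff[OF N] by simp
    qed
    moreover have "t > 0"
    proof -
      have "real c \<le> (1 + \<epsilon>) * real c" using assms by (simp add: algebra_simps)
      then show ?thesis using t c by linarith
    qed
    ultimately have "dynamic_choice_number r G \<le> t"
      unfolding dynamic_choice_number_def r by (intro Least_le) auto
    then show "real (dynamic_choice_number r G) \<le> (1 + \<epsilon>) * real (choice_number G)"
      using t unfolding c_def by linarith
  qed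
qed
end
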